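(* Let $a > 0$, let $S$ be a subset of $[-a,a]$, let $d$ be a positive real number, and let $H_1$ and $H_2$ be probability distributions on $S$. If $$\mathcal{AS}[H_1; d](z) = \mathcal{AS}[H_2; d](z) \quad \text{for all complex } z \text{ with } |z| < \frac{1}{a},$$ then $H_1 = H_2$.
   Context: Additive Stieltjes transform (AST): if $X$ is a random variable with distribution $H$ on a subset $S$ of $[-a,a]$, $a>0$, and $d$ is a positive real number, its AST is $$\mathcal{AS}[H; d](z) = E\left[\frac{1}{(1-zX)^d}\right] = \int_S \frac{1}{(1-zx)^d}\, dH(x), \qquad |z| < \frac{1}{a}.$$ For $|z|<1/a$ and $|x| \le a$ one has $|zx|<1$, and $(1-zx)^{-d}$ is taken with the principal branch. *)

theory Defs
  imports "HOL-Probability.Probability"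
begin

(* A distribution on S is a probability measure on S itself, carrying the trace of the
   Borel sigma-algebra of the reals; so space H = S and S need not be a Borel set. *)
definition distribution_on :: "real set \<Rightarrow> real measure \<Rightarrow> bool" where
  "distribution_on S H \<longleftrightarrow> prob_space H \<and> sets H = sets (restrict_space borel S)"

(* The Bochner integral runs over space H, which is S when H is a distribution on S.
   If S is contained in {-a..a} and cmod z < 1/a, the integrand is bounded and continuous
   on S, so the default value of the integral of a non-integrable function does not occur.
   There Re (1 - z * x) > 0, and complex powr is the principal branch exp (d * Ln _). *)
definition AST :: "real measure \<Rightarrow> real \<Rightarrow> complex \<Rightarrow> complex" where
  "AST H d z = (LINT x|H. 1 / (1 - z * complex_of_real x) powr complex_of_real d)"

end

theory Submission
  imports Defs "HOL-Complex_Analysis.Cauchy_Integral_Formula"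
begin

text \<open>Expanding \<open>(1 - z x) powr (- d)\<close> in powers of \<open>z\<close> under the integral, the binomial
  coefficients are all nonzero, so the transform determines the moments of the distribution.
  The support is bounded, so the characteristic function is in turn a power series in the
  moments, and Levy's uniqueness theorem applies.\<close>

text \<open>Since \<open>\<bar>x\<bar> \<le> a\<close> on the space,
  \<open>cmod (c n) * a ^ n\<close> dominates the terms uniformly in \<open>x\<close>, and finite
  mass lets sum and integral be exchanged. Serves both the binomial series of the transform and the
  exponential series of the characteristic function.\<close>

lemma power_series_integral_sums:
  fixes c :: "nat \<Rightarrow> complex" and M :: "real measure"
  assumes "finite_measure M"
    and [measurable]: "(\<lambda>x. x) \<in> M \<rightarrow>\<^sub>M (borel :: real measure)"
    and bounded: "\<And>x. x \<in> space M \<Longrightarrow> \<bar>x\<bar> \<le> a"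
    and summable: "summable (\<lambda>n. cmod (c n) * a ^ n)"
    and sums: "\<And>x. x \<in> space M \<Longrightarrow> (\<lambda>n. c n * of_real x ^ n) sums f x"
  shows "(\<lambda>n. c n * (LINT x|M. of_real x ^ n)) sums (LINT x|M. f x)"
proof -
  interpret finite_measure M
    by fact
  have le: "norm (c n * of_real x ^ n) \<le> cmod (c n) * a ^ n" if "x \<in> space M" for x n
    using bounded[OF that] by (simp add: norm_mult norm_power power_mono mult_left_mono)
  have int: "integrable M (\<lambda>x. c n * of_real x ^ n)" for n
    by (rule integrable_const_bound[where B = "cmod (c n) * a ^ n"]) (auto intro: le)
  have nsum: "summable (\<lambda>n. norm (c n * of_real x ^ n))" if "x \<in> space M" for x
    by (rule summable_comparison_test'[OF summable]) (use le[OF that] in auto)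
  have "(\<lambda>n. LINT x|M. c n * of_real x ^ n) sums (LINT x|M. (\<Sum>n. c n * of_real x ^ n))"
  proof (rule sums_integral[OF int])
    show "AE x in M. summable (\<lambda>n. norm (c n * of_real x ^ n))"
      using nsum by auto
    show "summable (\<lambda>n. LINT x|M. norm (c n * of_real x ^ n))"
    \<comment> \<open>The majorant times the total mass is the integral of the constant
      majorant.\<close>
    proof (rule summable_comparison_test'[OF summable_mult2[OF summable, of "measure M (space M)"]])
      fix n
      have "(LINT x|M. norm (c n * of_real x ^ n)) \<le> (LINT x|M. cmod (c n) * a ^ n)"
        using int le by (intro integral_mono integrable_norm) auto
      then show "norm (LINT x|M. norm (c n * of_real x ^ n))
          \<le> cmod (c n) * a ^ n * measure M (space M)"
        by (simp add: mult_ac)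
    qed
  qed
  moreover have "(LINT x|M. (\<Sum>n. c n * of_real x ^ n)) = (LINT x|M. f x)"
    by (intro Bochner_Integration.integral_cong refl) (use sums in \<open>auto simp: sums_iff\<close>)
  ultimately show ?thesis
    by simp
qed

lemma powser_sums_zero_imp_coeff_zero:
  fixes c :: "nat \<Rightarrow> complex"
  assumes "0 < r" "\<And>z. cmod z < r \<Longrightarrow> (\<lambda>n. c n * z ^ n) sums 0"
  shows "c n = 0"
proof (cases "n = 0")
  case True
  then show ?thesis
    using assms(2)[of 0] \<open>0 < r\<close> by simp
next
  case False
  show ?thesis
  proof (rule ccontr)
    assume "c n \<noteq> 0"
    \<comment> \<open>A nonzero coefficient of positive index would make 0 an isolated zero of the
      sum. The sum is the zero function, so any point of the punctured disc, here \<open>s\<close>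
      itself, gives a contradiction.\<close>
    with False assms obtain s :: real
      where "0 < s" "\<And>z :: complex. z \<in> cball 0 s - {0} \<Longrightarrow> (0 :: complex) \<noteq> 0"
      using powser_0_nonzero[of r 0 c "\<lambda>_. 0" n] by auto
    from this(2)[of "of_real s"] \<open>0 < s\<close> show False
      by simp
  qed
qed

text \<open>The inclusion of \<open>S\<close> into the line is measurable even for non-Borel
  \<open>S\<close>, because the preimage of a Borel set \<open>B\<close> is
  \<open>S \<inter> B\<close>, a member of the trace sigma-algebra.\<close>

lemma distribution_onD:
  assumes "distribution_on S H"
  shows "prob_space H" "sets H = sets (restrict_space borel S)" "space H = S"
    "(\<lambda>x. x) \<in> H \<rightarrow>\<^sub>M borel"
proof -
  show "prob_space H" and sets: "sets H = sets (restrict_space borel S)"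
    using assms by (auto simp: distribution_on_def)
  show "space H = S"
    using sets_eq_imp_space_eq[OF sets] by (simp add: space_restrict_space)
  show "(\<lambda>x. x) \<in> H \<rightarrow>\<^sub>M borel"
    unfolding measurable_cong_sets[OF sets refl] by (rule measurable_restrict_space1) simp
qed

lemma AST_sums:
  assumes "0 < a" "S \<subseteq> {-a..a}" "distribution_on S H" "cmod z < 1 / a"
  shows "(\<lambda>n. ((- of_real d gchoose n) * (-1) ^ n * (LINT x|H. of_real x ^ n)) * z ^ n) sums AST H d z"
proof -
  note H = distribution_onD[OF assms(3)]
  interpret prob_space H
    by (rule H)
  have za: "cmod z * a < 1"
    using assms by (simp add: field_simps)
  have bound: "\<bar>x\<bar> \<le> a" if "x \<in> space H" for x
    using that assms(2) H(3) by force
  define c where "c n = (- of_real d gchoose n) * (- z) ^ n" for n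
  \<comment> \<open>The midpoint of \<open>cmod z * a\<close> and 1 still lies in the unit disc,
    where the binomial series converges. It strictly exceeds \<open>cmod z * a\<close>, so
    convergence at \<open>z * a\<close> is absolute, which gives the majorant.\<close>
  have "summable (\<lambda>n. (- of_real d gchoose n) * (of_real ((1 + cmod z * a) / 2) :: complex) ^ n)"
    by (rule sums_summable[OF gen_binomial_complex])
       (use za assms in \<open>simp del: of_real_add of_real_mult of_real_divide\<close>)
  then have "summable (\<lambda>n. norm ((- of_real d gchoose n) * (z * of_real a) ^ n))"
    by (rule powser_insidea)
       (use za assms in \<open>simp add: norm_mult mult.commute del: of_real_add of_real_mult of_real_divide\<close>)
  then have summable: "summable (\<lambda>n. cmod (c n) * a ^ n)"
    using assms by (simp add: c_def norm_mult norm_power power_mult_distrib mult.assoc)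
  have "(\<lambda>n. c n * of_real x ^ n) sums (1 / (1 - z * of_real x) powr of_real d)"
    if "x \<in> space H" for x
  proof -
    have "cmod (- (z * of_real x)) < 1"
      using za mult_left_mono[OF bound[OF that], of "cmod z"] by (simp add: norm_mult)
    from gen_binomial_complex[OF this, of "- of_real d"] show ?thesis
      by (simp add: c_def powr_minus_divide power_mult_distrib[symmetric] mult.assoc)
  qed
  from power_series_integral_sums[OF finite_measure_axioms H(4) bound summable this] show ?thesis
    unfolding AST_def c_def by (simp add: power_minus[of z] mult_ac)
qed

text \<open>The numerator is a product of factors \<open>- d - i\<close>, each a negative real for
  \<open>d > 0\<close>. This is what allows moments to be read off from the coefficients.\<close>

lemma gbinomial_neg_of_real_nonzero:
  assumes "0 < d"
  shows "(- of_real d :: complex) gchoose n \<noteq> 0"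
proof -
  have "- of_real d - of_nat i \<noteq> (0 :: complex)" for i
  proof -
    have "- of_real d - of_nat i = (of_real (- d - real i) :: complex)"
      by simp
    moreover have "- d - real i \<noteq> 0"
      using assms by simp
    ultimately show ?thesis
      by (metis of_real_eq_0_iff)
  qed
  then show ?thesis
    by (simp add: gbinomial_prod_rev)
qed

lemma distribution_on_eqI_moments:
  assumes "S \<subseteq> {-a..a}" "distribution_on S H1" "distribution_on S H2"
    and moments: "\<And>n. (LINT x|H1. (of_real x :: complex) ^ n) = (LINT x|H2. of_real x ^ n)"
  shows "H1 = H2"
proof -
  note prob = distribution_onD(1) and sets = distribution_onD(2)
    and space = distribution_onD(3) and meas = distribution_onD(4)
  \<comment> \<open>Boundedness by \<open>a\<close> gives the majorant
    \<open>(\<bar>t\<bar> * a) ^ n / fact n\<close>, so the expansion holds for every real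
    \<open>t\<close>, as uniqueness of characteristic functions requires.\<close>
  have char: "(\<lambda>n. (\<i> * of_real t) ^ n / fact n * (LINT x|H. of_real x ^ n)) sums
      char (distr H borel (\<lambda>x. x)) t" if "distribution_on S H" for H t
  proof -
    interpret prob_space H
      by (rule prob[OF that])
    note [measurable] = meas[OF that]
    have "(\<lambda>n. (\<i> * of_real t) ^ n / fact n * (LINT x|H. of_real x ^ n)) sums
        (LINT x|H. iexp (t * x))"
    proof (rule power_series_integral_sums[where a = a])
      show "\<bar>x\<bar> \<le> a" if "x \<in> space H" for x
        using that assms(1) space[OF \<open>distribution_on S H\<close>] by force
      show "summable (\<lambda>n. cmod ((\<i> * of_real t) ^ n / fact n) * a ^ n)"
        using summable_exp_generic[of "\<bar>t\<bar> * a"]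
        by (simp add: norm_divide norm_mult norm_power power_mult_distrib field_simps)
      show "(\<lambda>n. (\<i> * of_real t) ^ n / fact n * of_real x ^ n) sums iexp (t * x)" for x
        using exp_converges[of "\<i> * of_real (t * x)"]
        by (simp add: scaleR_conv_of_real power_mult_distrib field_simps)
    qed (rule finite_measure_axioms meas[OF that])+
    then show ?thesis
      by (simp add: char_def integral_distr)
  qed
  have real_distr: "real_distribution (distr H borel (\<lambda>x. x))" if "distribution_on S H" for H
    using prob_space.prob_space_distr[OF prob[OF that] meas[OF that]]
    by (simp add: real_distribution_def real_distribution_axioms_def)
  have "distr H1 borel (\<lambda>x. x) = distr H2 borel (\<lambda>x. x)"
    using char[OF assms(2)] char[OF assms(3)]
    by (intro Levy_uniqueness real_distr assms(2,3)) (auto simp: fun_eq_iff moments intro: sums_unique2)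
  \<comment> \<open>Levy's theorem only identifies the pushforwards to the Borel line. They
    determine the measures on \<open>S\<close>, since every set of the trace sigma-algebra is
    \<open>S \<inter> B\<close> with \<open>B\<close> Borel.\<close>
  moreover have "emeasure H (S \<inter> B) = emeasure (distr H borel (\<lambda>x. x)) B"
    if "distribution_on S H" "B \<in> sets borel" for H B
    using meas[OF that(1)] space[OF that(1)] that(2)
    by (simp add: emeasure_distr Int_commute vimage_def Int_def)
  ultimately show ?thesis
    using sets assms(2,3)
    by (intro measure_eqI) (auto simp: sets_restrict_space)
qed

theorem theorem2p1:
  fixes a d :: real and S :: "real set" and H1 H2 :: "real measure"
  assumes "a > 0"
    and "S \<subseteq> {-a..a}"
    and "d > 0"
    and "distribution_on S H1"
    and "distribution_on S H2"
    and "\<And>z. cmod z < 1 / a \<Longrightarrow> AST H1 d z = AST H2 d z"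
  shows "H1 = H2"
proof (rule distribution_on_eqI_moments[OF assms(2,4,5)])
  fix n
  let ?b = "\<lambda>n. (- of_real d gchoose n) * (-1) ^ n :: complex"
  let ?m = "\<lambda>H n. LINT x|H. (of_real x :: complex) ^ n"
  \<comment> \<open>Equal transforms make the difference of the two expansions vanish on the whole
    disc, so all its coefficients are zero; the nonzero factor \<open>?b n\<close> then
    cancels.\<close>
  have "(\<lambda>n. (?b n * ?m H1 n - ?b n * ?m H2 n) * z ^ n) sums 0" if "cmod z < 1 / a" for z
    using sums_diff[OF AST_sums[OF assms(1,2,4) that, of d] AST_sums[OF assms(1,2,5) that, of d]]
      assms(6)[OF that] by (simp add: left_diff_distrib)
  then have "?b n * ?m H1 n - ?b n * ?m H2 n = 0"
    using assms(1) by (intro powser_sums_zero_imp_coeff_zero[where r = "1 / a"]) auto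
  then show "?m H1 n = ?m H2 n"
    using gbinomial_neg_of_real_nonzero[OF assms(3), of n] by simp
qed

end
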